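(* Let $d\ge 2$. Three homogeneous forms $f_0,f_1,f_2\in\mathbb{C}[x_0,x_1,x_2]_d$ are the determinantal equations of the eigenscheme of some form $f\in\mathbb{C}[x_0,x_1,x_2]_d$ if and only if $$x_0f_0-x_1f_1+x_2f_2=0\quad\text{and}\quad \partial_0f_0-\partial_1f_1+\partial_2f_2=0.$$ In other words, the subset of $(\mathbb{C}[x_0,x_1,x_2]_d)^{\oplus 3}$ parametrizing triples of determinantal equations of eigenschemes of ternary forms of degree $d$ is the linear subspace defined by these two identities.
   Context: $\mathbb{C}[x_0,x_1,x_2]_d$ is the space of homogeneous polynomials of degree $d$, and $\partial_i=\partial/\partial x_i$. The eigenscheme $E(f)\subseteq\mathbb{P}^2$ of $f\in\mathbb{C}[x_0,x_1,x_2]_d$ is defined by the $2\times2$ minors of $\begin{pmatrix}x_0&x_1&x_2\\ \partial_0f&\partial_1f&\partial_2f\end{pmatrix}$. The triple $(f_0,f_1,f_2)$ is called the triple of determinantal equations (determinantal basis) of the eigenscheme of $f$ if $f_0=x_1\partial_2f-x_2\partial_1f$, $f_1=x_0\partial_2f-x_2\partial_0f$ and $f_2=x_0\partial_1f-x_1\partial_0f$. *)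

theory Defs
  imports
    Complex_Main
    "HOL-Library.Poly_Mapping"
    "HOL-Library.Numeral_Type"
    "HOL-Library.Product_Plus"
begin

text \<open>
  Ternary polynomials over the complex numbers are finitely supported maps from exponent vectors
  to coefficients; the ring operations are those of \<^theory>\<open>HOL-Library.Poly_Mapping\<close>
  (convolution product). The three variables are indexed by the three-element type \<^typ>\<open>3\<close>,
  whose elements are 0, 1, 2.
\<close>

type_synonym ternary_poly = "(3 \<Rightarrow>\<^sub>0 nat) \<Rightarrow>\<^sub>0 complex"

definition X :: "3 \<Rightarrow> ternary_poly" where
  "X i = Poly_Mapping.single (Poly_Mapping.single i 1) 1"

definition total_degree :: "(3 \<Rightarrow>\<^sub>0 nat) \<Rightarrow> nat" where
  "total_degree m = (\<Sum>i\<in>UNIV. Poly_Mapping.lookup m i)"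

text \<open>The space of homogeneous polynomials of degree \<open>d\<close>; it contains the zero polynomial.\<close>

definition forms :: "nat \<Rightarrow> ternary_poly set" where
  "forms d = {p. \<forall>m\<in>Poly_Mapping.keys p. total_degree m = d}"

text \<open>
  Formal partial derivative. The truncated subtraction of exponents is harmless: a monomial not
  involving the variable \<open>i\<close> gets coefficient 0.
\<close>

definition pd :: "3 \<Rightarrow> ternary_poly \<Rightarrow> ternary_poly" where
  "pd i p = (\<Sum>m\<in>Poly_Mapping.keys p.
     Poly_Mapping.single (m - Poly_Mapping.single i 1)
       (of_nat (Poly_Mapping.lookup m i) * Poly_Mapping.lookup p m))"

text \<open>
  The \<open>2 \<times> 2\<close> minors of the matrix with rows \<open>x\<^sub>0, x\<^sub>1, x\<^sub>2\<close> and
  \<open>\<partial>\<^sub>0 f, \<partial>\<^sub>1 f, \<partial>\<^sub>2 f\<close>: the \<open>k\<close>-th entry omits column \<open>k\<close>.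
\<close>

definition determinantal_equations ::
  "ternary_poly \<Rightarrow> ternary_poly \<times> ternary_poly \<times> ternary_poly" where
  "determinantal_equations f =
     (X 1 * pd 2 f - X 2 * pd 1 f,
      X 0 * pd 2 f - X 2 * pd 0 f,
      X 0 * pd 1 f - X 1 * pd 0 f)"

definition scale_poly :: "complex \<Rightarrow> ternary_poly \<Rightarrow> ternary_poly" where
  "scale_poly c p = Poly_Mapping.map ((*) c) p"

definition scale_triple ::
  "complex \<Rightarrow> ternary_poly \<times> ternary_poly \<times> ternary_poly
    \<Rightarrow> ternary_poly \<times> ternary_poly \<times> ternary_poly" where
  "scale_triple c = (\<lambda>(p, q, r). (scale_poly c p, scale_poly c q, scale_poly c r))"

lemma scale_poly_eq: "scale_poly c p = Poly_Mapping.single 0 c * p"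
  by (simp add: scale_poly_def mult_map_scale_conv_mult)

interpretation triple: vector_space scale_triple
  by unfold_locales
    (auto simp: scale_triple_def scale_poly_eq single_add mult_single distrib_left distrib_right
      mult.assoc[symmetric])

lemma lookup_pd:
  "Poly_Mapping.lookup (pd i p) m =
     of_nat (Poly_Mapping.lookup m i + 1) * Poly_Mapping.lookup p (m + Poly_Mapping.single i 1)"
proof -
  let ?e = "Poly_Mapping.single i 1 :: 3 \<Rightarrow>\<^sub>0 nat"
  let ?c = "\<lambda>n. of_nat (Poly_Mapping.lookup n i) * Poly_Mapping.lookup p n :: complex"
  have shift: "n = m + ?e" if "n - ?e = m" "Poly_Mapping.lookup n i \<noteq> 0" for n
  proof (rule poly_mapping_eqI)
    fix j
    show "Poly_Mapping.lookup n j = Poly_Mapping.lookup (m + ?e) j"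
      using that by (auto simp: lookup_add lookup_minus lookup_single when_def)
  qed
  have "Poly_Mapping.lookup (pd i p) m =
      (\<Sum>n\<in>Poly_Mapping.keys p. if n - ?e = m then ?c n else 0)"
    by (simp add: pd_def lookup_sum lookup_single when_def)
  also have "\<dots> = (\<Sum>n\<in>Poly_Mapping.keys p. if n = m + ?e then ?c n else 0)"
    by (rule sum.cong) (use shift in auto)
  also have "\<dots> = ?c (m + ?e)"
    by (simp add: sum.delta in_keys_iff)
  finally show ?thesis
    by (simp add: lookup_add)
qed

end

theory Submission
  imports Defs
begin

text \<open>
  Encode the triple as the vector field \<open>g = (f\<^sub>0, - f\<^sub>1, f\<^sub>2)\<close>; determinantal triples are the
  fields \<open>x \<times> \<nabla>f\<close>, and the two identities say \<open>x \<cdot> g = 0\<close> and \<open>div g = 0\<close>. Necessity is a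
  computation. For sufficiency put \<open>c = curl g\<close>. Euler's identity and \<open>x \<cdot> g = 0\<close> give
  \<open>x \<times> c = - (d + 1) g\<close>, whence \<open>x \<cdot> curl c = 0\<close> because \<open>div g = 0\<close>. So \<open>curl c\<close> satisfies the
  same two identities in degree \<open>d - 2\<close>, and by induction \<open>curl c = x \<times> \<nabla>u\<close>. Then \<open>H = c + u x\<close>
  is curl-free and homogeneous of degree \<open>d - 1\<close>, so \<open>\<nabla>(x \<cdot> H) = d H\<close> and
  \<open>x \<times> \<nabla>(x \<cdot> H) = d (x \<times> c) = - d (d + 1) g\<close>.
\<close>

section \<open>Calculus of formal partial derivatives\<close>

lemma UNIV_three: "(UNIV :: 3 set) = {0, 1, 2}"
proof (intro equalityI subsetI)
  fix x :: 3
  show "x \<in> {0, 1, 2}"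
  proof (cases x)
    case (of_int z)
    then have "z = 0 \<or> z = 1 \<or> z = 2"
      by simp linarith
    with of_int(1) show ?thesis
      by (elim disjE) simp_all
  qed
qed (rule UNIV_I)

lemma sum_three: "(\<Sum>i\<in>UNIV. h (i::3)) = h 0 + h 1 + h 2"
proof -
  have "(0::3) \<noteq> 1" "(0::3) \<noteq> 2" "(1::3) \<noteq> 2"
    by simp_all
  then show ?thesis
    unfolding UNIV_three by (simp add: add.assoc)
qed

lemma pd_zero [simp]: "pd i 0 = 0"
  by (simp add: pd_def)

lemma pd_add: "pd i (p + q) = pd i p + pd i q"
  by (rule poly_mapping_eqI) (simp add: lookup_pd lookup_add algebra_simps)

lemma pd_minus: "pd i (- p) = - pd i p"
  by (rule poly_mapping_eqI) (simp add: lookup_pd)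

lemma pd_diff: "pd i (p - q) = pd i p - pd i q"
  by (rule poly_mapping_eqI) (simp add: lookup_pd lookup_minus algebra_simps)

lemma pd_sum: "pd i (\<Sum>x\<in>A. h x) = (\<Sum>x\<in>A. pd i (h x))"
  by (induction A rule: infinite_finite_induct) (simp_all add: pd_add)

lemma pd_single:
  "pd i (Poly_Mapping.single m c) =
     Poly_Mapping.single (m - Poly_Mapping.single i 1) (of_nat (Poly_Mapping.lookup m i) * c)"
  by (cases "c = 0") (simp_all add: pd_def)

lemma pd_commute: "pd i (pd j p) = pd j (pd i p)"
  by (rule poly_mapping_eqI)
    (auto simp: lookup_pd lookup_add lookup_single when_def add_ac)

lemma ternary_poly_sum_monomials:
  "(p :: ternary_poly) =
     (\<Sum>m\<in>Poly_Mapping.keys p. Poly_Mapping.single m (Poly_Mapping.lookup p m))"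
  by (rule poly_mapping_eqI) (simp add: lookup_sum lookup_single when_def in_keys_iff)

lemma X_mult_single:
  "X i * Poly_Mapping.single m c = Poly_Mapping.single (Poly_Mapping.single i 1 + m) c"
  by (simp add: X_def mult_single)

lemma single_add_diff_cancel:
  fixes m :: "3 \<Rightarrow>\<^sub>0 nat"
  assumes "Poly_Mapping.lookup m i \<noteq> 0"
  shows "Poly_Mapping.single i 1 + (m - Poly_Mapping.single i 1) = m"
  by (rule poly_mapping_eqI)
    (use assms in \<open>auto simp: lookup_add lookup_minus lookup_single when_def\<close>)

text \<open>Monomials are eigenvectors of \<open>X i * pd i\<close>, with the exponent as
  eigenvalue. When the exponent is 0 the coefficient vanishes, which hides the truncated subtraction
  in \<open>pd\<close>.\<close>

lemma X_mult_pd_single: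
  "X i * pd i (Poly_Mapping.single m c) =
     Poly_Mapping.single m (of_nat (Poly_Mapping.lookup m i) * c)"
proof (cases "Poly_Mapping.lookup m i = 0")
  case False
  then show ?thesis
    unfolding pd_single X_mult_single by (simp add: single_add_diff_cancel[simplified])
qed (simp add: pd_single)

lemma pd_X_mult_single:
  "pd i (X j * Poly_Mapping.single m c) =
     X j * pd i (Poly_Mapping.single m c) + (if i = j then Poly_Mapping.single m c else 0)"
proof (cases "i = j")
  case True
  then show ?thesis
    by (simp add: X_mult_pd_single) (simp add: X_mult_single pd_single lookup_add
        distrib_right single_add add.commute)
next
  case False
  have "Poly_Mapping.single j 1 + m - Poly_Mapping.single i 1
      = Poly_Mapping.single j 1 + (m - Poly_Mapping.single i 1)"
    by (rule poly_mapping_eqI)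
      (use False in \<open>auto simp: lookup_add lookup_minus lookup_single when_def\<close>)
  with False show ?thesis
    by (simp add: X_mult_single pd_single lookup_add lookup_single)
qed

lemma pd_X_mult: "pd i (X j * p) = X j * pd i p + (if i = j then p else 0)"
proof -
  \<comment> \<open>Naming the summands hides the coefficients of \<open>p\<close>, so that at the
    end the whole sum can be folded back into \<open>p\<close>.\<close>
  define M where "M m = Poly_Mapping.single m (Poly_Mapping.lookup p m)" for m
  have p: "p = (\<Sum>m\<in>Poly_Mapping.keys p. M m)"
    unfolding M_def by (rule ternary_poly_sum_monomials)
  have "pd i (X j * (\<Sum>m\<in>Poly_Mapping.keys p. M m)) =
      X j * pd i (\<Sum>m\<in>Poly_Mapping.keys p. M m)
        + (if i = j then (\<Sum>m\<in>Poly_Mapping.keys p. M m) else 0)"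
    by (simp add: sum_distrib_left pd_sum pd_X_mult_single M_def sum.distrib)
  then show ?thesis
    by (simp flip: p)
qed

lemma pd_const_mult:
  "pd i (Poly_Mapping.single 0 c * p) = Poly_Mapping.single 0 c * pd i p"
proof -
  define M where "M m = Poly_Mapping.single m (Poly_Mapping.lookup p m)" for m
  have p: "p = (\<Sum>m\<in>Poly_Mapping.keys p. M m)"
    unfolding M_def by (rule ternary_poly_sum_monomials)
  have "pd i (Poly_Mapping.single 0 c * (\<Sum>m\<in>Poly_Mapping.keys p. M m)) =
      Poly_Mapping.single 0 c * pd i (\<Sum>m\<in>Poly_Mapping.keys p. M m)"
    by (simp add: sum_distrib_left pd_sum pd_single M_def mult_single mult_ac)
  then show ?thesis
    by (simp flip: p)
qed

text \<open>By linearity it suffices to treat monomials, where the three eigenvalues of the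
  operators \<open>X i * pd i\<close> are the exponents, with sum \<open>d\<close>.\<close>

lemma euler_identity:
  assumes "p \<in> forms d"
  shows "X 0 * pd 0 p + X 1 * pd 1 p + X 2 * pd 2 p = of_nat d * p"
proof -
  define M where "M m = Poly_Mapping.single m (Poly_Mapping.lookup p m)" for m
  have p: "p = (\<Sum>m\<in>Poly_Mapping.keys p. M m)"
    unfolding M_def by (rule ternary_poly_sum_monomials)
  have mon: "X 0 * pd 0 (M m) + X 1 * pd 1 (M m) + X 2 * pd 2 (M m) = of_nat d * M m"
    if "m \<in> Poly_Mapping.keys p" for m
  proof -
    have "Poly_Mapping.lookup m 0 + Poly_Mapping.lookup m 1 + Poly_Mapping.lookup m 2 = d"
      using assms that by (auto simp: forms_def total_degree_def sum_three)
    then have "of_nat d * M m = Poly_Mapping.single m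
        (of_nat (Poly_Mapping.lookup m 0 + Poly_Mapping.lookup m 1 + Poly_Mapping.lookup m 2)
          * Poly_Mapping.lookup p m)"
      by (simp add: M_def mult_single flip: single_of_nat)
    then show ?thesis
      by (simp add: M_def X_mult_pd_single distrib_right flip: single_add)
  qed
  have "X 0 * pd 0 (\<Sum>m\<in>Poly_Mapping.keys p. M m) + X 1 * pd 1 (\<Sum>m\<in>Poly_Mapping.keys p. M m)
      + X 2 * pd 2 (\<Sum>m\<in>Poly_Mapping.keys p. M m) = of_nat d * (\<Sum>m\<in>Poly_Mapping.keys p. M m)"
    using mon by (simp add: pd_sum sum_distrib_left flip: sum.distrib)
  then show ?thesis
    by (simp flip: p)
qed

section \<open>Homogeneity under ring operations and derivatives\<close>

lemma forms_zero [simp]: "0 \<in> forms d"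
  by (simp add: forms_def)

lemma forms_add: "p \<in> forms d \<Longrightarrow> q \<in> forms d \<Longrightarrow> p + q \<in> forms d"
  using keys_add[of p q] by (auto simp: forms_def)

lemma forms_minus: "p \<in> forms d \<Longrightarrow> - p \<in> forms d"
  by (simp add: forms_def)

lemma forms_diff: "p \<in> forms d \<Longrightarrow> q \<in> forms d \<Longrightarrow> p - q \<in> forms d"
  using forms_add[of p d "- q"] by (simp add: forms_minus)

lemma total_degree_add: "total_degree (m + n) = total_degree m + total_degree n"
  by (simp add: total_degree_def lookup_add sum.distrib)

lemma total_degree_single [simp]: "total_degree (Poly_Mapping.single i k) = k"
  by (simp add: total_degree_def lookup_single when_def)

lemma total_degree_zero [simp]: "total_degree 0 = 0"
  by (simp add: total_degree_def)

lemma forms_mult: "p \<in> forms d \<Longrightarrow> q \<in> forms e \<Longrightarrow> p * q \<in> forms (d + e)"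
  using keys_mult[of p q] by (fastforce simp: forms_def total_degree_add)

lemma X_forms: "X i \<in> forms 1"
  by (simp add: forms_def X_def)

lemma forms_X_mult: "p \<in> forms d \<Longrightarrow> X i * p \<in> forms (Suc d)"
  using forms_mult[OF X_forms] by simp

lemma forms_const_mult: "p \<in> forms d \<Longrightarrow> Poly_Mapping.single 0 c * p \<in> forms d"
  using forms_mult[of "Poly_Mapping.single 0 c" 0 p d] by (simp add: forms_def)

lemma forms_pd:
  assumes "p \<in> forms (Suc d)"
  shows "pd i p \<in> forms d"
  unfolding forms_def
proof (intro CollectI ballI)
  fix m assume "m \<in> Poly_Mapping.keys (pd i p)"
  then have "m + Poly_Mapping.single i 1 \<in> Poly_Mapping.keys p"
    by (simp add: in_keys_iff lookup_pd)
  with assms have "total_degree (m + Poly_Mapping.single i 1) = Suc d"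
    by (simp add: forms_def)
  then show "total_degree m = d"
    by (simp add: total_degree_add)
qed

text \<open>Covers the degree that \<open>forms_pd\<close> leaves out; it serves the base cases
  below.\<close>

lemma pd_forms_0:
  assumes "p \<in> forms 0"
  shows "pd i p = 0"
proof (rule poly_mapping_eqI)
  fix m
  have "m + Poly_Mapping.single i 1 \<notin> Poly_Mapping.keys p"
    using assms by (auto simp: forms_def total_degree_add)
  then show "Poly_Mapping.lookup (pd i p) m = Poly_Mapping.lookup 0 m"
    by (simp add: lookup_pd in_keys_iff)
qed

section \<open>Necessity of the two identities\<close>

lemma determinantal_equations_forms:
  assumes "f \<in> forms d" "(f0, f1, f2) = determinantal_equations f"
  shows "f0 \<in> forms d" "f1 \<in> forms d" "f2 \<in> forms d"
proof -
  have "X i * pd j f \<in> forms d" for i j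
    by (cases d) (use assms(1) in \<open>auto simp: pd_forms_0 intro: forms_X_mult forms_pd\<close>)
  then show "f0 \<in> forms d" "f1 \<in> forms d" "f2 \<in> forms d"
    using assms(2) by (auto simp: determinantal_equations_def intro: forms_diff)
qed

text \<open>Expansion of a determinant with the row of variables repeated.\<close>

lemma determinantal_equations_orthogonal:
  assumes "(f0, f1, f2) = determinantal_equations f"
  shows "X 0 * f0 - X 1 * f1 + X 2 * f2 = 0"
proof -
  have f: "f0 = X 1 * pd 2 f - X 2 * pd 1 f" "f1 = X 0 * pd 2 f - X 2 * pd 0 f"
    "f2 = X 0 * pd 1 f - X 1 * pd 0 f"
    using assms by (simp_all add: determinantal_equations_def)
  show ?thesis
    unfolding f by (simp add: algebra_simps)
qed

text \<open>Entry \<open>k\<close> involves only variables other than \<open>X k\<close>, so the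
  product rule leaves only second derivatives, which cancel in pairs by symmetry.\<close>

lemma determinantal_equations_divergence:
  assumes "(f0, f1, f2) = determinantal_equations f"
  shows "pd 0 f0 - pd 1 f1 + pd 2 f2 = 0"
  using assms
  by (simp add: determinantal_equations_def pd_diff pd_X_mult pd_commute[of 1 0]
      pd_commute[of 2 0] pd_commute[of 2 1])

section \<open>Sufficiency by vector calculus\<close>

lemma curl_cross_orthogonal:
  assumes f: "f0 \<in> forms d" "f1 \<in> forms d" "f2 \<in> forms d"
    and orth: "X 0 * f0 - X 1 * f1 + X 2 * f2 = 0"
    and c: "c0 = pd 1 f2 + pd 2 f1" "c1 = pd 2 f0 - pd 0 f2" "c2 = - pd 0 f1 - pd 1 f0"
  shows "X 1 * c2 - X 2 * c1 = - (of_nat (Suc d) * f0)"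
    and "X 0 * c2 - X 2 * c0 = - (of_nat (Suc d) * f1)"
    and "X 0 * c1 - X 1 * c0 = - (of_nat (Suc d) * f2)"
proof -
  \<comment> \<open>With g = (\<open>f0\<close>, -\<open>f1\<close>, \<open>f2\<close>), component i
    reads g_i + sum_j x_j d_i g_j = 0. Subtracting Euler's sum_j x_j d_j g_i = d g_i leaves
    component i of x cross curl g, equal to -(d + 1) g_i.\<close>
  have grad: "pd i (X 0 * f0 - X 1 * f1 + X 2 * f2) = 0" for i
    using orth by simp
  note expand = pd_add pd_diff pd_X_mult
  show "X 1 * c2 - X 2 * c1 = - (of_nat (Suc d) * f0)"
    using grad[of 0] euler_identity[OF f(1)] unfolding c expand
    by simp algebra
  show "X 0 * c2 - X 2 * c0 = - (of_nat (Suc d) * f1)"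
    using grad[of 1] euler_identity[OF f(2)] unfolding c expand
    by simp algebra
  show "X 0 * c1 - X 1 * c0 = - (of_nat (Suc d) * f2)"
    using grad[of 2] euler_identity[OF f(3)] unfolding c expand
    by simp algebra
qed

text \<open>Poincare lemma for homogeneous fields: symmetry of the derivatives turns d_i F = h_i +
  sum_j x_j d_i h_j into h_i plus an Euler sum for h_i.\<close>

lemma curl_free_imp_gradient:
  assumes h: "h0 \<in> forms d" "h1 \<in> forms d" "h2 \<in> forms d"
    and curl: "pd 1 h2 = pd 2 h1" "pd 0 h2 = pd 2 h0" "pd 0 h1 = pd 1 h0"
    and F: "F = X 0 * h0 + X 1 * h1 + X 2 * h2"
  shows "pd 0 F = of_nat (Suc d) * h0"
    and "pd 1 F = of_nat (Suc d) * h1"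
    and "pd 2 F = of_nat (Suc d) * h2"
  using euler_identity[OF h(1)] euler_identity[OF h(2)] euler_identity[OF h(3)] curl
  unfolding F pd_add pd_X_mult by (simp_all add: algebra_simps)

lemma determinantal_equations_const_mult:
  "determinantal_equations (Poly_Mapping.single 0 c * f) =
     scale_triple c (determinantal_equations f)"
  unfolding determinantal_equations_def pd_const_mult
  by (simp add: scale_triple_def scale_poly_eq algebra_simps)

lemma determinantal_equations_add:
  "determinantal_equations (f + g) = determinantal_equations f + determinantal_equations g"
  by (simp add: determinantal_equations_def pd_add algebra_simps)

text \<open>Stated in every degree because the induction descends two degrees at a time and ends in
  degree 0 or 1.\<close>

lemma ex_determinantal_equations:
  assumes "f0 \<in> forms d" "f1 \<in> forms d" "f2 \<in> forms d"
    and "X 0 * f0 - X 1 * f1 + X 2 * f2 = 0"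
    and "pd 0 f0 - pd 1 f1 + pd 2 f2 = 0"
  shows "\<exists>f\<in>forms d. (f0, f1, f2) = determinantal_equations f"
  using assms
proof (induction d arbitrary: f0 f1 f2 rule: less_induct)
  case (less d)
  define c0 where "c0 = pd 1 f2 + pd 2 f1"
  define c1 where "c1 = pd 2 f0 - pd 0 f2"
  define c2 where "c2 = - pd 0 f1 - pd 1 f0"
  note c_defs = c0_def c1_def c2_def
  note cross = curl_cross_orthogonal[OF less.prems(1-4) c_defs]
  show ?case
  proof (cases d)
    case 0
    then have "c0 = 0" "c1 = 0" "c2 = 0"
      using less.prems by (simp_all add: c_defs pd_forms_0)
    then have "f0 = 0" "f1 = 0" "f2 = 0"
      using cross 0 by simp_all
    then show ?thesis
      by (intro bexI[of _ 0]) (simp_all add: determinantal_equations_def)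
  next
    case (Suc n)
    have c_forms: "c0 \<in> forms n" "c1 \<in> forms n" "c2 \<in> forms n"
      unfolding c_defs using less.prems Suc
      by (auto intro!: forms_add forms_diff forms_minus forms_pd)
    \<comment> \<open>The curl of c, with the middle sign flipped to match the sign convention for
      \<open>f1\<close>.\<close>
    define k0 where "k0 = pd 1 c2 - pd 2 c1"
    define k1 where "k1 = pd 0 c2 - pd 2 c0"
    define k2 where "k2 = pd 0 c1 - pd 1 c0"
    note k_defs = k0_def k1_def k2_def
    have k_div: "pd 0 k0 - pd 1 k1 + pd 2 k2 = 0"
      by (simp add: k_defs pd_diff pd_commute[of 1 0] pd_commute[of 2 0] pd_commute[of 2 1])
    have k_orth: "X 0 * k0 - X 1 * k1 + X 2 * k2 = 0"
    proof -
      have of_nat_pd: "pd i (- (of_nat (Suc d) * p)) = - (of_nat (Suc d) * pd i p)" for i p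
        by (simp add: pd_minus pd_const_mult flip: single_of_nat)
      \<comment> \<open>This is div(x cross c) = - x . curl c, the other term c . curl x being
        zero.\<close>
      have "- (X 0 * k0 - X 1 * k1 + X 2 * k2) =
          pd 0 (X 1 * c2 - X 2 * c1) - pd 1 (X 0 * c2 - X 2 * c0) + pd 2 (X 0 * c1 - X 1 * c0)"
        unfolding k_defs pd_diff pd_X_mult by (simp add: algebra_simps)
      also have "\<dots> = - (of_nat (Suc d) * (pd 0 f0 - pd 1 f1 + pd 2 f2))"
        unfolding cross of_nat_pd by (simp add: algebra_simps)
      finally show ?thesis
        unfolding less.prems(5) mult_zero_right minus_zero neg_equal_0_iff_equal .
    qed
    \<comment> \<open>Only the degree of \<open>X i * u\<close> is recorded: for
      \<open>n = 0\<close> the choice is \<open>u = 0\<close>, and a degree \<open>n - 1\<close>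
      would be truncated.\<close>
    obtain u where u: "(k0, k1, k2) = determinantal_equations u"
      and u_forms: "\<And>i. X i * u \<in> forms n"
    proof (cases n)
      case 0
      then have "(k0, k1, k2) = determinantal_equations 0"
        using c_forms by (simp add: k_defs pd_forms_0 determinantal_equations_def)
      then show ?thesis
        by (rule that) simp
    next
      case (Suc l)
      have "k0 \<in> forms l" "k1 \<in> forms l" "k2 \<in> forms l"
        unfolding k_defs using c_forms Suc by (auto intro!: forms_diff forms_pd)
      then obtain u where "u \<in> forms l" "(k0, k1, k2) = determinantal_equations u"
        using less.IH[of l k0 k1 k2] k_orth k_div Suc \<open>d = Suc n\<close> by auto
      then show ?thesis
        using that Suc forms_X_mult by blast
    qed
    \<comment> \<open>Since curl(u x) = - x cross grad u, adding u x to c cancels the curl of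
      c.\<close>
    define h0 where "h0 = c0 + X 0 * u"
    define h1 where "h1 = c1 + X 1 * u"
    define h2 where "h2 = c2 + X 2 * u"
    note h_defs = h0_def h1_def h2_def
    have h_forms: "h0 \<in> forms n" "h1 \<in> forms n" "h2 \<in> forms n"
      unfolding h_defs using c_forms u_forms by (auto intro: forms_add)
    have curl: "pd 1 h2 = pd 2 h1" "pd 0 h2 = pd 2 h0" "pd 0 h1 = pd 1 h0"
      using u unfolding h_defs k_defs determinantal_equations_def pd_add pd_X_mult
      by (simp_all add: algebra_simps)
    define F where "F = X 0 * h0 + X 1 * h1 + X 2 * h2"
    have F_forms: "F \<in> forms d"
      unfolding F_def Suc by (intro forms_add forms_X_mult h_forms)
    \<comment> \<open>The factor \<open>d\<close> comes from the gradient of \<open>F\<close>, as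
      the h_i have degree \<open>n\<close> with \<open>d = Suc n\<close>; the factor
      \<open>- Suc d\<close> comes from \<open>cross\<close>.\<close>
    define N :: complex where "N = - of_nat (d * Suc d)"
    have "N \<noteq> 0"
      using Suc unfolding N_def by (simp del: of_nat_mult of_nat_Suc)
    have N_single: "Poly_Mapping.single 0 N = - (of_nat d * of_nat (Suc d) :: ternary_poly)"
      unfolding N_def single_uminus single_of_nat by (simp only: of_nat_mult)
    note grad = curl_free_imp_gradient[OF h_forms curl F_def, folded Suc]
    \<comment> \<open>The terms \<open>X i * u\<close> drop out because x cross x = 0.\<close>
    have "determinantal_equations F =
        (of_nat d * (X 1 * c2 - X 2 * c1), of_nat d * (X 0 * c2 - X 2 * c0),
         of_nat d * (X 0 * c1 - X 1 * c0))"
      by (simp add: determinantal_equations_def grad h_defs algebra_simps)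
    also have "\<dots> = scale_triple N (f0, f1, f2)"
      unfolding cross by (simp add: scale_triple_def scale_poly_eq N_single algebra_simps)
    finally have "determinantal_equations (Poly_Mapping.single 0 (inverse N) * F) = (f0, f1, f2)"
      using \<open>N \<noteq> 0\<close> by (simp add: determinantal_equations_const_mult)
    then show ?thesis
      using forms_const_mult[OF F_forms] by metis
  qed
qed

section \<open>The linear subspace of determinantal triples\<close>

lemma subspace_determinantal_equations:
  "triple.subspace (determinantal_equations ` forms d)"
proof (rule triple.subspaceI)
  show "0 \<in> determinantal_equations ` forms d"
    by (rule image_eqI[of _ _ 0]) (simp_all add: determinantal_equations_def zero_prod_def)
next
  fix x y
  assume "x \<in> determinantal_equations ` forms d" "y \<in> determinantal_equations ` forms d"
  then show "x + y \<in> determinantal_equations ` forms d"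
    by (auto simp: forms_add simp flip: determinantal_equations_add)
next
  fix c x
  assume "x \<in> determinantal_equations ` forms d"
  then show "scale_triple c x \<in> determinantal_equations ` forms d"
    by (auto simp: forms_const_mult simp flip: determinantal_equations_const_mult)
qed

theorem theorem2:
  fixes d :: nat
  assumes "d \<ge> 2"
  shows "(\<forall>f0\<in>forms d. \<forall>f1\<in>forms d. \<forall>f2\<in>forms d.
            (\<exists>f\<in>forms d. (f0, f1, f2) = determinantal_equations f) \<longleftrightarrow>
              X 0 * f0 - X 1 * f1 + X 2 * f2 = 0 \<and>
              pd 0 f0 - pd 1 f1 + pd 2 f2 = 0)
       \<and> determinantal_equations ` forms d =
            {(f0, f1, f2). f0 \<in> forms d \<and> f1 \<in> forms d \<and> f2 \<in> forms d \<and>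
              X 0 * f0 - X 1 * f1 + X 2 * f2 = 0 \<and>
              pd 0 f0 - pd 1 f1 + pd 2 f2 = 0}
       \<and> module.subspace scale_triple (determinantal_equations ` forms d)"
proof (intro conjI)
  show iff: "\<forall>f0\<in>forms d. \<forall>f1\<in>forms d. \<forall>f2\<in>forms d.
      (\<exists>f\<in>forms d. (f0, f1, f2) = determinantal_equations f) \<longleftrightarrow>
        X 0 * f0 - X 1 * f1 + X 2 * f2 = 0 \<and> pd 0 f0 - pd 1 f1 + pd 2 f2 = 0"
    using ex_determinantal_equations determinantal_equations_orthogonal
      determinantal_equations_divergence by meson
  show "determinantal_equations ` forms d =
      {(f0, f1, f2). f0 \<in> forms d \<and> f1 \<in> forms d \<and> f2 \<in> forms d \<and>
        X 0 * f0 - X 1 * f1 + X 2 * f2 = 0 \<and> pd 0 f0 - pd 1 f1 + pd 2 f2 = 0}"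
    (is "_ = ?R")
  proof (rule set_eqI)
    fix t :: "ternary_poly \<times> ternary_poly \<times> ternary_poly"
    obtain f0 f1 f2 where t: "t = (f0, f1, f2)"
      by (cases t)
    have "t \<in> determinantal_equations ` forms d \<longleftrightarrow>
        (\<exists>f\<in>forms d. (f0, f1, f2) = determinantal_equations f)"
      by (auto simp: t image_iff)
    \<comment> \<open>The equivalence presupposes entries in \<open>forms d\<close>; for a
      determinantal triple, \<open>determinantal_equations_forms\<close> provides this.\<close>
    also have "\<dots> \<longleftrightarrow> t \<in> ?R"
      using iff determinantal_equations_forms unfolding t mem_Collect_eq prod.case by meson
    finally show "t \<in> determinantal_equations ` forms d \<longleftrightarrow> t \<in> ?R" .
  qed
  show "triple.subspace (determinantal_equations ` forms d)"
    by (rule subspace_determinantal_equations)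
qed

end
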